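(* Let $d\ge 1$, let $X=\{x_1,x_2\}$ be a list of two items with unit-norm feature vectors $x_1,x_2\in\mathbb{R}^d$, and let $U_1,U_2$ be the finite nonempty sets of users associated with items $1$ and $2$, respectively. Suppose the two items have fully overlapping users, i.e. $U_1=U_2$, and that the modification cost scale is $\alpha=0$. Then for every $f$, i.e. for every assignment of unit-norm embeddings $u_i\in\mathbb{R}^d$ to the users $i\in U_1=U_2$ (for which the average user vectors $\tilde v_1,\tilde v_2$ are well defined), the diversity of the strategically modified list $X^f=(\Delta_f(x_1),\Delta_f(x_2))$ is zero: $\mathrm{div}(X^f,r^f)=0$.
   Context: There are finitely many users and items. Each item $j$ has a feature vector $x_j\in\mathbb{R}^d$ with $\|x_j\|_2=1$, and is associated with a finite nonempty set $U_j$ of users. A model $f$ is given by an assignment of an embedding $u_i\in\mathbb{R}^d$ with $\|u_i\|_2=1$ to every user $i$; the score of item $x$ for user $i$ is $f(x;u_i)=u_i^\top x$. Average user of item $j$: $v_j=\frac{1}{|U_j|}\sum_{i\in U_j}u_i$ and $\tilde v_j=v_j/\|v_j\|_2$ (defined when $v_j\neq 0$). Best response of item $j$ with cost scale $\alpha\ge 0$: $\Delta_f(x_j)=\operatorname{argmax}_{x'\in\mathbb{R}^d,\ \|x'\|_2=1}\ \tilde v_j^\top x'-\alpha\|x_j-x'\|_2^2$. In this result $\alpha=0$, so $\Delta_f(x_j)$ is the unit vector maximizing $\tilde v_j^\top x'$. Diversity: for a list of $k$ unit-norm items $X$ with ranking $r$ (where $r(\ell)$ is the index of the $\ell$-th ranked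 item), $\mathrm{div}(X,r)=\frac{1}{k(k-1)}\sum_{j,\ell=1}^{k}\bigl(1-x_{r(j)}^\top x_{r(\ell)}\bigr)$. Here $k=2$ (both items are recommended), so the value does not depend on the ranking. $r^f$ denotes the ranking of $X^f$ by score. *)

theory Defs
  imports "HOL-Analysis.Analysis"
begin

text \<open>A model is given by its user embeddings \<open>u :: 'user \<Rightarrow> real ^ 'd\<close>.\<close>

definition score :: "real ^ 'd \<Rightarrow> real ^ 'd \<Rightarrow> real" where
  "score ui x = ui \<bullet> x"

definition avg_user :: "('user \<Rightarrow> real ^ 'd) \<Rightarrow> 'user set \<Rightarrow> real ^ 'd" where
  "avg_user u U = (1 / real (card U)) *\<^sub>R (\<Sum>i\<in>U. u i)"

text \<open>Meaningful only when \<open>avg_user u U \<noteq> 0\<close>; division by zero makes it 0 otherwise.\<close>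

definition norm_avg_user :: "('user \<Rightarrow> real ^ 'd) \<Rightarrow> 'user set \<Rightarrow> real ^ 'd" where
  "norm_avg_user u U = (1 / norm (avg_user u U)) *\<^sub>R avg_user u U"

definition is_best_response ::
    "real \<Rightarrow> ('user \<Rightarrow> real ^ 'd) \<Rightarrow> 'user set \<Rightarrow> real ^ 'd \<Rightarrow> real ^ 'd \<Rightarrow> bool" where
  "is_best_response \<alpha> u U x =
    is_arg_max (\<lambda>x'. norm_avg_user u U \<bullet> x' - \<alpha> * (norm (x - x'))\<^sup>2) (\<lambda>x'. norm x' = 1)"

text \<open>On unit vectors the objective equals \<open>(v + 2 * \<alpha> * x) \<bullet> x' - 2 * \<alpha>\<close>, where \<open>v\<close> is the
  normalized average user and \<open>x\<close> the original item, so the maximizer exists and is unique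
  unless \<open>v + 2 * \<alpha> * x = 0\<close>. In that degenerate case the value below is unspecified;
  it cannot occur for \<open>\<alpha> = 0\<close>, as \<open>v\<close> then has norm 1 whenever it is well defined.\<close>

definition best_response ::
    "real \<Rightarrow> ('user \<Rightarrow> real ^ 'd) \<Rightarrow> 'user set \<Rightarrow> real ^ 'd \<Rightarrow> real ^ 'd" where
  "best_response \<alpha> u U x = (THE x'. is_best_response \<alpha> u U x x')"

text \<open>Items and ranks are numbered from 0, as for list indices: \<open>r l\<close> is the index of the item
  in position \<open>l\<close>. Ties in the score may be broken arbitrarily.\<close>

definition is_ranking :: "real ^ 'd \<Rightarrow> (real ^ 'd) list \<Rightarrow> (nat \<Rightarrow> nat) \<Rightarrow> bool" where
  "is_ranking ui X r \<longleftrightarrow>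
    bij_betw r {..<length X} {..<length X} \<and>
    (\<forall>j l. j < l \<and> l < length X \<longrightarrow> score ui (X ! r l) \<le> score ui (X ! r j))"

definition diversity :: "(real ^ 'd) list \<Rightarrow> (nat \<Rightarrow> nat) \<Rightarrow> real" where
  "diversity X r =
    1 / (real (length X) * (real (length X) - 1)) *
    (\<Sum>j<length X. \<Sum>l<length X. 1 - X ! r j \<bullet> X ! r l)"

end

theory Submission
  imports Defs
begin

text \<open>With \<open>\<alpha> = 0\<close> the best response is the normalized average user itself, which depends on
  the item only through its user set. Two items with the same users therefore move to the same
  unit vector.\<close>

lemma norm_norm_avg_user:
  assumes "avg_user u U \<noteq> 0"
  shows "norm (norm_avg_user u U) = 1"
  using assms by (simp add: norm_avg_user_def)

text \<open>Cauchy-Schwarz bounds the objective by 1 on the unit sphere, and its equality case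
  leaves \<open>v\<close> as the only maximizer. The equivalence, rather than mere maximality of
  \<open>v\<close>, is what evaluates the \<open>THE\<close> in
  \<open>best_response\<close>.\<close>

lemma is_arg_max_inner_unit_iff:
  fixes v :: "'a::real_inner"
  assumes "norm v = 1"
  shows "is_arg_max (\<lambda>y. v \<bullet> y) (\<lambda>y. norm y = 1) y \<longleftrightarrow> y = v"
proof -
  have vv: "v \<bullet> v = 1"
    using assms by (simp add: dot_square_norm)
  have le: "v \<bullet> z \<le> 1" if "norm z = 1" for z
    using norm_cauchy_schwarz[of v z] assms that by simp
  have eq: "z = v" if "norm z = 1" "1 \<le> v \<bullet> z" for z
  proof -
    \<comment> \<open>Equality in Cauchy-Schwarz makes \<open>v\<close> and \<open>z\<close>
      positively parallel; equal norms then give \<open>z = v\<close>.\<close>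
    have "v \<bullet> z = norm v * norm z"
      using le[of z] that assms by simp
    then show ?thesis
      using norm_cauchy_schwarz_eq[of v z] assms that by simp
  qed
  show ?thesis
  proof
    assume "is_arg_max (\<lambda>y. v \<bullet> y) (\<lambda>y. norm y = 1) y"
    \<comment> \<open>The competitor is \<open>v\<close> itself, whose value already attains the
      bound 1.\<close>
    then have "norm y = 1" "v \<bullet> v \<le> v \<bullet> y"
      using assms by (auto simp: is_arg_max_linorder)
    then show "y = v"
      using vv eq by simp
  qed (use assms le vv in \<open>auto simp: is_arg_max_linorder\<close>)
qed

lemma best_response_zero_cost:
  assumes "avg_user u U \<noteq> 0"
  shows "best_response 0 u U x = norm_avg_user u U"
  using is_arg_max_inner_unit_iff[OF norm_norm_avg_user[OF assms]]
  by (simp add: best_response_def is_best_response_def)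

text \<open>Every summand is \<open>1 - v \<bullet> v = 0\<close>. The condition on \<open>r\<close>
  keeps all lookups inside the list, where \<open>!\<close> is specified.\<close>

lemma diversity_replicate_unit:
  assumes "norm v = 1" and "r ` {..<n} \<subseteq> {..<n}"
  shows "diversity (replicate n v) r = 0"
proof -
  have "replicate n v ! r j = v" if "j < n" for j
    using assms(2) that by (intro nth_replicate) auto
  then show ?thesis
    using assms(1) by (simp add: diversity_def dot_square_norm)
qed

theorem proposition1:
  fixes x1 x2 :: "real ^ 'd"
    and users U1 U2 :: "'user set"
    and \<alpha> :: real
  assumes "norm x1 = 1" and "norm x2 = 1"
    and "finite users"
    and "U1 \<subseteq> users" and "U1 \<noteq> {}"
    and "U2 \<subseteq> users" and "U2 \<noteq> {}"
    and "U1 = U2"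
    and "\<alpha> = 0"
  shows "\<forall>u :: 'user \<Rightarrow> real ^ 'd.
    (\<forall>i\<in>users. norm (u i) = 1) \<and> avg_user u U1 \<noteq> 0 \<and> avg_user u U2 \<noteq> 0 \<longrightarrow>
    (let Xf = [best_response \<alpha> u U1 x1, best_response \<alpha> u U2 x2]
     in \<forall>i\<in>users. \<forall>r. is_ranking (u i) Xf r \<longrightarrow> diversity Xf r = 0)"
proof (intro allI impI, unfold Let_def, intro ballI allI impI)
  fix u :: "'user \<Rightarrow> real ^ 'd" and i r
  let ?Xf = "[best_response \<alpha> u U1 x1, best_response \<alpha> u U2 x2]"
  assume u: "(\<forall>i\<in>users. norm (u i) = 1) \<and> avg_user u U1 \<noteq> 0 \<and> avg_user u U2 \<noteq> 0"
    and r: "is_ranking (u i) ?Xf r"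
  \<comment> \<open>Here \<open>U1 = U2\<close> enters: both best responses are the same normalized
    average.\<close>
  have "?Xf = replicate 2 (norm_avg_user u U1)"
    using u assms by (simp add: best_response_zero_cost numeral_2_eq_2)
  moreover have "r ` {..<2} \<subseteq> {..<2}"
    using r by (simp add: is_ranking_def bij_betw_def numeral_2_eq_2)
  ultimately show "diversity ?Xf r = 0"
    using u by (metis diversity_replicate_unit norm_norm_avg_user)
qed

end
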